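(* Let $A_m\in\mathbf{U}_m$. The following are equivalent: (i) $A_m$ is an extreme point of $\mathbf{U}_m$; (ii) every entry $a_{ij}$ of $A_m$ with $0<a_{ij}<1$ has at least one saturated neighborhood, and its minimal saturated neighborhood $A_\alpha$ is an extreme point of $\mathbf{U}_{|\alpha|}$; (iii) every entry $a_{ij}$ of $A_m$ with $0<a_{ij}<1$ has at least one saturated neighborhood, and every saturated principal submatrix $A_\alpha$ of $A_m$ is an extreme point of $\mathbf{U}_{|\alpha|}$.
   Context: $I_m=\{1,\dots,m\}$. $\mathbf{U}_m$ is the set of real $m\times m$ matrices $A_m=(a_{ij})$ with $a_{ij}=a_{ji}\ge 0$ for all $i,j$ and $\sum_{i,j\in\alpha}a_{ij}\le|\alpha|$ for every $\alpha\subset I_m$ ($|\alpha|$ the cardinality); it is convex. For $\alpha\subset I_m$ the principal submatrix $A_\alpha=(a_{ij})_{i,j\in\alpha}$ is regarded as an $|\alpha|\times|\alpha|$ matrix. A nonempty $\alpha\subset I_m$ is saturated (for $A_m$) if $\sum_{i,j\in\alpha}a_{ij}=|\alpha|$, and $A_\alpha$ is then a saturated principal submatrix. A saturated neighborhood of the entry $a_{ij}$ is a saturated principal submatrix $A_\beta$ with $i,j\in\beta$; its radius is $|\beta|$; the minimal saturated neighborhood is the one of minimal radius (unique when it exists). *)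

theory Defs
  imports Complex_Main "Jordan_Normal_Form.DL_Submatrix"
begin

text \<open>Indices start at 0, so the index set $I_m$ is \<open>{..<m}\<close>.\<close>

definition Uset :: "nat \<Rightarrow> real mat set" where
  "Uset m = {A \<in> carrier_mat m m.
     (\<forall>i<m. \<forall>j<m. A $$ (i, j) = A $$ (j, i) \<and> 0 \<le> A $$ (i, j)) \<and>
     (\<forall>\<alpha>\<subseteq>{..<m}. (\<Sum>i\<in>\<alpha>. \<Sum>j\<in>\<alpha>. A $$ (i, j)) \<le> real (card \<alpha>))}"

text \<open>Matrices of varying dimension form no \<open>real_vector\<close> type, so \<open>extreme_point_of\<close> of
  HOL-Analysis is not applicable to them; this is the same notion spelled out: a point of \<open>S\<close> lying
  in no open segment between two distinct points of \<open>S\<close>.\<close>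

definition extreme_mat_of :: "real mat \<Rightarrow> real mat set \<Rightarrow> bool" where
  "extreme_mat_of A S \<longleftrightarrow> A \<in> S \<and>
     (\<forall>B\<in>S. \<forall>C\<in>S. \<not> (B \<noteq> C \<and> (\<exists>u::real. 0 < u \<and> u < 1 \<and> A = (1 - u) \<cdot>\<^sub>m B + u \<cdot>\<^sub>m C)))"

abbreviation principal_submatrix :: "real mat \<Rightarrow> nat set \<Rightarrow> real mat" where
  "principal_submatrix A \<alpha> \<equiv> submatrix A \<alpha> \<alpha>"

definition saturated :: "real mat \<Rightarrow> nat set \<Rightarrow> bool" where
  "saturated A \<alpha> \<longleftrightarrow> \<alpha> \<noteq> {} \<and> \<alpha> \<subseteq> {..<dim_row A} \<and>
     (\<Sum>i\<in>\<alpha>. \<Sum>j\<in>\<alpha>. A $$ (i, j)) = real (card \<alpha>)"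

text \<open>A saturated neighborhood is represented by its index set \<open>\<beta>\<close>; its radius is \<open>card \<beta>\<close>.\<close>

definition saturated_nbhd :: "real mat \<Rightarrow> nat \<Rightarrow> nat \<Rightarrow> nat set \<Rightarrow> bool" where
  "saturated_nbhd A i j \<beta> \<longleftrightarrow> saturated A \<beta> \<and> i \<in> \<beta> \<and> j \<in> \<beta>"

definition minimal_saturated_nbhd :: "real mat \<Rightarrow> nat \<Rightarrow> nat \<Rightarrow> nat set \<Rightarrow> bool" where
  "minimal_saturated_nbhd A i j \<alpha> \<longleftrightarrow> saturated_nbhd A i j \<alpha> \<and>
     (\<forall>\<beta>. saturated_nbhd A i j \<beta> \<longrightarrow> card \<alpha> \<le> card \<beta>)"

lemma saturated_Int:
  assumes A: "A \<in> Uset m" and a: "saturated A \<alpha>" and b: "saturated A \<beta>" and ne: "\<alpha> \<inter> \<beta> \<noteq> {}"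
  shows "saturated A (\<alpha> \<inter> \<beta>)"
proof -
  let ?s = "\<lambda>\<gamma>. \<Sum>i\<in>\<gamma>. \<Sum>j\<in>\<gamma>. A $$ (i, j)"
  have dim: "dim_row A = m" using A by (auto simp: Uset_def)
  have sub: "\<alpha> \<subseteq> {..<m}" "\<beta> \<subseteq> {..<m}" using a b dim by (auto simp: saturated_def)
  have fin: "finite \<alpha>" "finite \<beta>" using sub finite_subset by blast+
  have nn: "0 \<le> A $$ (i, j)" if "i < m" "j < m" for i j using A that by (auto simp: Uset_def)
  have le: "?s \<gamma> \<le> real (card \<gamma>)" if "\<gamma> \<subseteq> {..<m}" for \<gamma> using A that by (auto simp: Uset_def)
  have s_prod: "?s \<gamma> = (\<Sum>p\<in>\<gamma> \<times> \<gamma>. A $$ p)" for \<gamma>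
    by (simp add: sum.cartesian_product)
  have "?s \<alpha> + ?s \<beta> = (\<Sum>p\<in>\<alpha>\<times>\<alpha> \<union> \<beta>\<times>\<beta>. A $$ p) + (\<Sum>p\<in>\<alpha>\<times>\<alpha> \<inter> \<beta>\<times>\<beta>. A $$ p)"
    unfolding s_prod using fin by (intro sum.union_inter [symmetric]) auto
  also have "\<alpha>\<times>\<alpha> \<inter> \<beta>\<times>\<beta> = (\<alpha> \<inter> \<beta>) \<times> (\<alpha> \<inter> \<beta>)" by auto
  also have "(\<Sum>p\<in>\<alpha>\<times>\<alpha> \<union> \<beta>\<times>\<beta>. A $$ p) \<le> (\<Sum>p\<in>(\<alpha> \<union> \<beta>) \<times> (\<alpha> \<union> \<beta>). A $$ p)"
    using fin sub nn by (intro sum_mono2) auto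
  finally have "?s \<alpha> + ?s \<beta> \<le> ?s (\<alpha> \<union> \<beta>) + ?s (\<alpha> \<inter> \<beta>)" unfolding s_prod by simp
  moreover have "?s \<alpha> = card \<alpha>" "?s \<beta> = card \<beta>" using a b by (auto simp: saturated_def)
  moreover have "real (card \<alpha>) + real (card \<beta>) = real (card (\<alpha> \<union> \<beta>)) + real (card (\<alpha> \<inter> \<beta>))"
    using card_Un_Int[OF fin] by linarith
  moreover have "?s (\<alpha> \<union> \<beta>) \<le> card (\<alpha> \<union> \<beta>)" "?s (\<alpha> \<inter> \<beta>) \<le> card (\<alpha> \<inter> \<beta>)"
    using sub by (auto intro!: le)
  ultimately have "?s (\<alpha> \<inter> \<beta>) = card (\<alpha> \<inter> \<beta>)" by linarith
  then show ?thesis using ne sub dim by (auto simp: saturated_def)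
qed

lemma minimal_saturated_nbhd_unique:
  assumes A: "A \<in> Uset m" and a: "minimal_saturated_nbhd A i j \<alpha>" and b: "minimal_saturated_nbhd A i j \<beta>"
  shows "\<alpha> = \<beta>"
proof -
  have sat: "saturated A \<alpha>" "saturated A \<beta>" and ij: "i \<in> \<alpha> \<inter> \<beta>" "j \<in> \<alpha> \<inter> \<beta>"
    using a b by (auto simp: minimal_saturated_nbhd_def saturated_nbhd_def)
  have fin: "finite \<alpha>" "finite \<beta>"
    using sat unfolding saturated_def by (meson finite_lessThan finite_subset)+
  have "saturated A (\<alpha> \<inter> \<beta>)" using saturated_Int[OF A sat] ij by blast
  then have "saturated_nbhd A i j (\<alpha> \<inter> \<beta>)" using ij by (simp add: saturated_nbhd_def)
  then have "card \<alpha> \<le> card (\<alpha> \<inter> \<beta>)" "card \<beta> \<le> card (\<alpha> \<inter> \<beta>)"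
    using a b by (auto simp: minimal_saturated_nbhd_def)
  then have "\<alpha> \<inter> \<beta> = \<alpha>" "\<alpha> \<inter> \<beta> = \<beta>"
    using fin by (meson card_seteq inf_le1 inf_le2)+
  then show ?thesis by simp
qed

end

theory Submission
  imports Defs
begin

text \<open>A symmetric \<open>D\<close> is neutral for \<open>A\<close> if it vanishes wherever \<open>A\<close> does and has sum 0 over
  every saturated principal submatrix of \<open>A\<close>. These conditions leave only strict inequalities to
  be preserved, so \<open>A \<plusminus> t D\<close> stays in \<open>U\<^sub>m\<close> for small \<open>t\<close>; conversely, the endpoints of a segment in
  \<open>U\<^sub>m\<close> through \<open>A\<close> differ by a neutral direction. Thus \<open>A\<close> is extreme iff 0 is its only neutral
  direction. Neutral directions of \<open>A\<close> restrict to neutral directions of \<open>A\<^sub>\<alpha>\<close>, so extremality can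
  be tested on principal submatrices that cover the entries strictly between 0 and 1 (at the
  entries 0 and 1 a neutral direction vanishes anyway). If \<open>\<alpha>\<close> is saturated, then neutral
  directions of \<open>A\<^sub>\<alpha>\<close> extend by zero to neutral directions of \<open>A\<close>, because saturated sets meeting
  \<open>\<alpha>\<close> meet it in a saturated set. At an entry without saturated neighborhood, the pair of symmetric
  matrix units is neutral.\<close>

section \<open>Submatrices and extension by zero\<close>

lemma bij_betw_pick:
  assumes "finite S"
  shows "bij_betw (pick S) {..<card S} S"
proof -
  have inj: "inj_on (pick S) {..<card S}"
    by (rule inj_onI) (metis card_pick_le lessThan_iff)
  have "pick S ` {..<card S} \<subseteq> S" using pick_in_set_le by auto
  then have "pick S ` {..<card S} = S"
    using assms inj by (intro card_subset_eq) (auto simp: card_image)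
  with inj show ?thesis by (simp add: bij_betw_def)
qed

lemma inj_on_pick:
  assumes "finite S" "T \<subseteq> {..<card S}"
  shows "inj_on (pick S) T"
  using bij_betw_imp_inj_on[OF bij_betw_pick[OF assms(1)]] assms(2) by (rule inj_on_subset)

lemma card_pick_image: "finite S \<Longrightarrow> T \<subseteq> {..<card S} \<Longrightarrow> card (pick S ` T) = card T"
  by (intro card_image inj_on_pick)

lemma pick_image_subset: "T \<subseteq> {..<card S} \<Longrightarrow> pick S ` T \<subseteq> S"
  using pick_in_set_le by blast

lemma pick_less: "S \<subseteq> {..<n} \<Longrightarrow> k < card S \<Longrightarrow> pick S k < n"
  using pick_in_set_le by blast

lemma pickE:
  assumes "finite S" "x \<in> S"
  obtains k where "k < card S" "x = pick S k"
  using bij_betw_imp_surj_on[OF bij_betw_pick[OF assms(1)]] assms(2) by blast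

lemma submatrix_carrier_mat:
  assumes "A \<in> carrier_mat nr nc" "I \<subseteq> {..<nr}" "J \<subseteq> {..<nc}"
  shows "submatrix A I J \<in> carrier_mat (card I) (card J)"
proof -
  have "{i. i < nr \<and> i \<in> I} = I" "{j. j < nc \<and> j \<in> J} = J" using assms by auto
  then show ?thesis using assms(1) by (intro carrier_matI) (simp_all add: dim_submatrix)
qed

lemma submatrix_index_pick:
  assumes "A \<in> carrier_mat nr nc" "I \<subseteq> {..<nr}" "J \<subseteq> {..<nc}" "k < card I" "l < card J"
  shows "submatrix A I J $$ (k, l) = A $$ (pick I k, pick J l)"
proof -
  have "{i. i < nr \<and> i \<in> I} = I" "{j. j < nc \<and> j \<in> J} = J" using assms by auto
  then show ?thesis using assms by (simp add: submatrix_index)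
qed

text \<open>For \<open>i \<in> I\<close>, the position \<open>k\<close> with \<open>pick I k = i\<close> is \<open>card {a \<in> I. a < i}\<close>.\<close>

definition zero_extension :: "nat \<Rightarrow> nat \<Rightarrow> nat set \<Rightarrow> nat set \<Rightarrow> 'a::zero mat \<Rightarrow> 'a mat" where
  "zero_extension nr nc I J B = mat nr nc (\<lambda>(i, j).
     if i \<in> I \<and> j \<in> J then B $$ (card {a \<in> I. a < i}, card {b \<in> J. b < j}) else 0)"

lemma zero_extension_carrier_mat: "zero_extension nr nc I J B \<in> carrier_mat nr nc"
  by (simp add: zero_extension_def)

lemma zero_extension_index_outside:
  assumes "i < nr" "j < nc" "i \<notin> I \<or> j \<notin> J"
  shows "zero_extension nr nc I J B $$ (i, j) = 0"
  using assms by (auto simp: zero_extension_def)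

lemma zero_extension_index_pick:
  assumes "I \<subseteq> {..<nr}" "J \<subseteq> {..<nc}" "k < card I" "l < card J"
  shows "zero_extension nr nc I J B $$ (pick I k, pick J l) = B $$ (k, l)"
  using assms pick_less[OF assms(1)] pick_less[OF assms(2)]
  by (simp add: zero_extension_def card_pick_le pick_in_set_le)

lemma submatrix_zero_extension:
  assumes "I \<subseteq> {..<nr}" "J \<subseteq> {..<nc}" "B \<in> carrier_mat (card I) (card J)"
  shows "submatrix (zero_extension nr nc I J B) I J = B"
  using submatrix_carrier_mat[OF zero_extension_carrier_mat assms(1,2)] assms
  by (intro eq_matI)
    (auto simp: submatrix_index_pick[OF zero_extension_carrier_mat] zero_extension_index_pick)

lemma submatrix_zero_mat:
  assumes "I \<subseteq> {..<nr}" "J \<subseteq> {..<nc}"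
  shows "submatrix (0\<^sub>m nr nc) I J = 0\<^sub>m (card I) (card J)"
  using submatrix_carrier_mat[OF zero_carrier_mat assms] pick_less[OF assms(1)] pick_less[OF assms(2)]
  by (intro eq_matI) (auto simp: submatrix_index_pick[OF zero_carrier_mat assms])

section \<open>Sums over principal submatrices\<close>

definition principal_sum :: "'a::comm_monoid_add mat \<Rightarrow> nat set \<Rightarrow> 'a" where
  "principal_sum A \<alpha> = (\<Sum>i\<in>\<alpha>. \<Sum>j\<in>\<alpha>. A $$ (i, j))"

lemma principal_sum_add:
  assumes "A \<in> carrier_mat m m" "B \<in> carrier_mat m m" "\<alpha> \<subseteq> {..<m}"
  shows "principal_sum (A + B) \<alpha> = principal_sum A \<alpha> + principal_sum B \<alpha>"
proof -
  have "principal_sum (A + B) \<alpha> = (\<Sum>i\<in>\<alpha>. \<Sum>j\<in>\<alpha>. A $$ (i, j) + B $$ (i, j))"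
    using assms unfolding principal_sum_def by (intro sum.cong) (auto simp: subset_iff)
  then show ?thesis by (simp add: principal_sum_def sum.distrib)
qed

lemma principal_sum_minus:
  fixes A B :: "'a::ab_group_add mat"
  assumes "A \<in> carrier_mat m m" "B \<in> carrier_mat m m" "\<alpha> \<subseteq> {..<m}"
  shows "principal_sum (A - B) \<alpha> = principal_sum A \<alpha> - principal_sum B \<alpha>"
proof -
  have "principal_sum (A - B) \<alpha> = (\<Sum>i\<in>\<alpha>. \<Sum>j\<in>\<alpha>. A $$ (i, j) - B $$ (i, j))"
    using assms unfolding principal_sum_def by (intro sum.cong) (auto simp: subset_iff)
  then show ?thesis by (simp add: principal_sum_def sum_subtractf)
qed

lemma principal_sum_smult:
  fixes A :: "'a::semiring_0 mat"
  assumes "A \<in> carrier_mat m m" "\<alpha> \<subseteq> {..<m}"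
  shows "principal_sum (c \<cdot>\<^sub>m A) \<alpha> = c * principal_sum A \<alpha>"
proof -
  have "principal_sum (c \<cdot>\<^sub>m A) \<alpha> = (\<Sum>i\<in>\<alpha>. \<Sum>j\<in>\<alpha>. c * A $$ (i, j))"
    using assms unfolding principal_sum_def by (intro sum.cong) (auto simp: subset_iff)
  then show ?thesis by (simp add: principal_sum_def sum_distrib_left)
qed

lemma principal_sum_submatrix:
  assumes A: "A \<in> carrier_mat m m" and \<alpha>: "\<alpha> \<subseteq> {..<m}" and \<gamma>: "\<gamma> \<subseteq> {..<card \<alpha>}"
  shows "principal_sum (submatrix A \<alpha> \<alpha>) \<gamma> = principal_sum A (pick \<alpha> ` \<gamma>)"
proof -
  have "inj_on (pick \<alpha>) \<gamma>"
    using finite_subset[OF \<alpha>] \<gamma> by (intro inj_on_pick) auto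
  then have "principal_sum A (pick \<alpha> ` \<gamma>) = (\<Sum>k\<in>\<gamma>. \<Sum>l\<in>\<gamma>. A $$ (pick \<alpha> k, pick \<alpha> l))"
    by (simp add: principal_sum_def sum.reindex)
  also have "\<dots> = principal_sum (submatrix A \<alpha> \<alpha>) \<gamma>"
    using \<gamma> unfolding principal_sum_def
    by (intro sum.cong refl) (auto simp: subset_iff submatrix_index_pick[OF A \<alpha> \<alpha>])
  finally show ?thesis by simp
qed

lemma principal_sum_zero_extension:
  assumes \<alpha>: "\<alpha> \<subseteq> {..<m}" and \<beta>: "\<beta> \<subseteq> {..<m}" and B: "B \<in> carrier_mat (card \<alpha>) (card \<alpha>)"
    and \<gamma>: "\<gamma> \<subseteq> {..<card \<alpha>}" "pick \<alpha> ` \<gamma> = \<alpha> \<inter> \<beta>"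
  shows "principal_sum (zero_extension m m \<alpha> \<alpha> B) \<beta> = principal_sum B \<gamma>"
proof -
  let ?E = "zero_extension m m \<alpha> \<alpha> B"
  have "principal_sum ?E \<beta> = (\<Sum>p\<in>\<beta> \<times> \<beta>. ?E $$ p)"
    by (simp add: principal_sum_def sum.cartesian_product)
  also have "\<dots> = (\<Sum>p\<in>(\<alpha> \<inter> \<beta>) \<times> (\<alpha> \<inter> \<beta>). ?E $$ p)"
    using \<beta> finite_subset[OF \<beta>]
    by (intro sum.mono_neutral_right) (auto intro!: zero_extension_index_outside)
  also have "\<dots> = principal_sum ?E (pick \<alpha> ` \<gamma>)"
    by (simp add: principal_sum_def sum.cartesian_product \<gamma>)
  also have "\<dots> = principal_sum B \<gamma>"
    by (simp add: principal_sum_submatrix[OF zero_extension_carrier_mat \<alpha> \<gamma>(1), symmetric]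
        submatrix_zero_extension[OF \<alpha> \<alpha> B])
  finally show ?thesis .
qed

section \<open>Saturated sets\<close>

lemma Uset_iff:
  "A \<in> Uset m \<longleftrightarrow> A \<in> carrier_mat m m \<and>
     (\<forall>i<m. \<forall>j<m. A $$ (i, j) = A $$ (j, i) \<and> 0 \<le> A $$ (i, j)) \<and>
     (\<forall>\<alpha>\<subseteq>{..<m}. principal_sum A \<alpha> \<le> real (card \<alpha>))"
  by (simp add: Uset_def principal_sum_def)

lemma Uset_carrier_mat: "A \<in> Uset m \<Longrightarrow> A \<in> carrier_mat m m"
  by (simp add: Uset_iff)

lemma Uset_sym: "A \<in> Uset m \<Longrightarrow> i < m \<Longrightarrow> j < m \<Longrightarrow> A $$ (i, j) = A $$ (j, i)"
  by (simp add: Uset_iff)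

lemma Uset_nonneg: "A \<in> Uset m \<Longrightarrow> i < m \<Longrightarrow> j < m \<Longrightarrow> 0 \<le> A $$ (i, j)"
  by (simp add: Uset_iff)

lemma Uset_principal_sum_le: "A \<in> Uset m \<Longrightarrow> \<alpha> \<subseteq> {..<m} \<Longrightarrow> principal_sum A \<alpha> \<le> real (card \<alpha>)"
  by (simp add: Uset_iff)

lemma saturated_iff:
  assumes "A \<in> carrier_mat m n"
  shows "saturated A \<alpha> \<longleftrightarrow> \<alpha> \<noteq> {} \<and> \<alpha> \<subseteq> {..<m} \<and> principal_sum A \<alpha> = real (card \<alpha>)"
  using assms by (simp add: saturated_def principal_sum_def)

lemma principal_submatrix_in_Uset:
  assumes A: "A \<in> Uset m" and \<alpha>: "\<alpha> \<subseteq> {..<m}"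
  shows "principal_submatrix A \<alpha> \<in> Uset (card \<alpha>)"
proof -
  note CA = Uset_carrier_mat[OF A]
  have "principal_sum (principal_submatrix A \<alpha>) \<gamma> \<le> real (card \<gamma>)" if \<gamma>: "\<gamma> \<subseteq> {..<card \<alpha>}" for \<gamma>
  proof -
    have "card (pick \<alpha> ` \<gamma>) = card \<gamma>"
      using finite_subset[OF \<alpha>] \<gamma> by (intro card_pick_image) auto
    moreover have "pick \<alpha> ` \<gamma> \<subseteq> {..<m}" using pick_image_subset[OF \<gamma>] \<alpha> by blast
    ultimately show ?thesis
      using Uset_principal_sum_le[OF A] principal_sum_submatrix[OF CA \<alpha> \<gamma>] by metis
  qed
  then show ?thesis
    using submatrix_carrier_mat[OF CA \<alpha> \<alpha>] pick_less[OF \<alpha>] Uset_sym[OF A] Uset_nonneg[OF A]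
    by (simp add: Uset_iff submatrix_index_pick[OF CA \<alpha> \<alpha>])
qed

lemma saturated_principal_submatrix_iff:
  assumes A: "A \<in> carrier_mat m m" and \<alpha>: "\<alpha> \<subseteq> {..<m}" and \<gamma>: "\<gamma> \<subseteq> {..<card \<alpha>}"
  shows "saturated (principal_submatrix A \<alpha>) \<gamma> \<longleftrightarrow> saturated A (pick \<alpha> ` \<gamma>)"
proof -
  have "card (pick \<alpha> ` \<gamma>) = card \<gamma>"
    using finite_subset[OF \<alpha>] \<gamma> by (intro card_pick_image) auto
  moreover have "pick \<alpha> ` \<gamma> \<subseteq> {..<m}" using pick_image_subset[OF \<gamma>] \<alpha> by blast
  ultimately show ?thesis
    using \<gamma> by (simp add: saturated_iff[OF A] saturated_iff[OF submatrix_carrier_mat[OF A \<alpha> \<alpha>]]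
        principal_sum_submatrix[OF A \<alpha> \<gamma>])
qed

lemma ex_minimal_saturated_nbhd:
  "saturated_nbhd A i j \<beta> \<Longrightarrow> \<exists>\<alpha>. minimal_saturated_nbhd A i j \<alpha>"
  using ex_has_least_nat[of "saturated_nbhd A i j" \<beta> card] by (auto simp: minimal_saturated_nbhd_def)

section \<open>Neutral directions and extremality\<close>

definition neutral_directions :: "nat \<Rightarrow> real mat \<Rightarrow> real mat set" where
  "neutral_directions m A = {D \<in> carrier_mat m m.
     (\<forall>i<m. \<forall>j<m. D $$ (i, j) = D $$ (j, i) \<and> (A $$ (i, j) = 0 \<longrightarrow> D $$ (i, j) = 0)) \<and>
     (\<forall>\<beta>. saturated A \<beta> \<longrightarrow> principal_sum D \<beta> = 0)}"

lemma neutral_directions_carrier_mat: "D \<in> neutral_directions m A \<Longrightarrow> D \<in> carrier_mat m m"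
  by (simp add: neutral_directions_def)

lemma convex_combination_eq_upper_bound:
  fixes a b c u :: "'a::linordered_field"
  assumes u: "0 < u" "u < 1" and "b \<le> a" "c \<le> a" and comb: "a = (1 - u) * b + u * c"
  shows "b = a" "c = a"
proof -
  have "(1 - u) * (a - b) + u * (a - c) = 0" using comb by (simp add: algebra_simps)
  moreover have "0 \<le> (1 - u) * (a - b)" "0 \<le> u * (a - c)" using assms by simp_all
  ultimately have "(1 - u) * (a - b) = 0" "u * (a - c) = 0" by linarith+
  then show "b = a" "c = a" using u by simp_all
qed

lemma segment_direction_neutral:
  assumes B: "B \<in> Uset m" and C: "C \<in> Uset m" and u: "0 < u" "u < 1"
    and A: "A = (1 - u) \<cdot>\<^sub>m B + u \<cdot>\<^sub>m C"
  shows "B - C \<in> neutral_directions m A"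
proof -
  note CB = Uset_carrier_mat[OF B] and CC = Uset_carrier_mat[OF C]
  have CA: "A \<in> carrier_mat m m" using A CB CC by simp
  have "B $$ (i, j) = C $$ (i, j)" if ij: "i < m" "j < m" and "A $$ (i, j) = 0" for i j
  proof -
    have "(1 - u) * B $$ (i, j) + u * C $$ (i, j) = 0" using that A CB CC by simp
    then show ?thesis
      using u Uset_nonneg[OF B ij] Uset_nonneg[OF C ij] by (simp add: add_nonneg_eq_0_iff)
  qed
  moreover have "principal_sum (B - C) \<beta> = 0" if \<beta>: "saturated A \<beta>" for \<beta>
  proof -
    have sub: "\<beta> \<subseteq> {..<m}" and "real (card \<beta>) = principal_sum A \<beta>"
      using \<beta> by (simp_all add: saturated_iff[OF CA])
    moreover have "principal_sum A \<beta> = (1 - u) * principal_sum B \<beta> + u * principal_sum C \<beta>"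
      using CB CC sub by (simp add: A principal_sum_add[of _ m] principal_sum_smult[of _ m])
    ultimately have "principal_sum B \<beta> = real (card \<beta>)" "principal_sum C \<beta> = real (card \<beta>)"
      using convex_combination_eq_upper_bound[OF u Uset_principal_sum_le[OF B]
          Uset_principal_sum_le[OF C]] by simp_all
    then show ?thesis by (simp add: principal_sum_minus[OF CB CC sub])
  qed
  ultimately show ?thesis
    using CB CC Uset_sym[OF B] Uset_sym[OF C] by (auto simp: neutral_directions_def)
qed

lemma eventually_perturbation_le:
  fixes a b d :: real
  assumes "a \<le> b" "a = b \<Longrightarrow> d = 0"
  shows "\<forall>\<^sub>F t in nhds 0. a + t * d \<le> b"
proof (cases "a = b")
  case True
  then show ?thesis using assms by simp
next
  case False
  have "((\<lambda>t. a + t * d) \<longlongrightarrow> a + 0 * d) (nhds 0)" by (intro tendsto_intros filterlim_ident)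
  then have "\<forall>\<^sub>F t in nhds 0. a + t * d < b"
    using False assms by (intro order_tendstoD) auto
  then show ?thesis by eventually_elim simp
qed

lemma eventually_neutral_perturbation_in_Uset:
  assumes A: "A \<in> Uset m" and D: "D \<in> neutral_directions m A"
  shows "\<forall>\<^sub>F t in nhds 0. A + t \<cdot>\<^sub>m D \<in> Uset m"
proof -
  note CA = Uset_carrier_mat[OF A]
  note CD = neutral_directions_carrier_mat[OF D]
  have "\<forall>\<^sub>F t in nhds 0. \<forall>i\<in>{..<m}. \<forall>j\<in>{..<m}. - A $$ (i, j) + t * - D $$ (i, j) \<le> 0"
    using Uset_nonneg[OF A] D
    by (intro eventually_ball_finite ballI eventually_perturbation_le)
      (auto simp: neutral_directions_def)
  moreover have "\<forall>\<^sub>F t in nhds 0. \<forall>\<beta>\<in>Pow {..<m}.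
      principal_sum A \<beta> + t * principal_sum D \<beta> \<le> real (card \<beta>)"
  proof (intro eventually_ball_finite ballI eventually_perturbation_le)
    fix \<beta> assume "\<beta> \<in> Pow {..<m}" "principal_sum A \<beta> = real (card \<beta>)"
    then have "\<beta> = {} \<or> saturated A \<beta>" by (simp add: saturated_iff[OF CA])
    then show "principal_sum D \<beta> = 0"
      using D by (auto simp: neutral_directions_def principal_sum_def)
  qed (use Uset_principal_sum_le[OF A] in auto)
  ultimately show ?thesis
  proof eventually_elim
    case (elim t)
    have index: "(A + t \<cdot>\<^sub>m D) $$ (i, j) = A $$ (i, j) + t * D $$ (i, j)" if "i < m" "j < m" for i j
      using that CA CD by simp
    have "0 \<le> A $$ (i, j) + t * D $$ (i, j)" if "i < m" "j < m" for i j
      using bspec[OF bspec[OF elim(1)], of i j] that by simp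
    moreover have "principal_sum (A + t \<cdot>\<^sub>m D) \<beta> \<le> real (card \<beta>)" if "\<beta> \<subseteq> {..<m}" for \<beta>
      using elim(2) that CA CD by (simp add: principal_sum_add principal_sum_smult)
    moreover have "D $$ (i, j) = D $$ (j, i)" if "i < m" "j < m" for i j
      using D that by (simp add: neutral_directions_def)
    ultimately show ?case
      using CA CD Uset_sym[OF A] by (simp add: Uset_iff index del: index_add_mat)
  qed
qed

lemma extreme_mat_of_imp_neutral_eq_0:
  assumes ext: "extreme_mat_of A (Uset m)" and D: "D \<in> neutral_directions m A"
  shows "D = 0\<^sub>m m m"
proof (rule ccontr)
  assume "D \<noteq> 0\<^sub>m m m"
  have A: "A \<in> Uset m" using ext by (simp add: extreme_mat_of_def)
  note CA = Uset_carrier_mat[OF A]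
  note CD = neutral_directions_carrier_mat[OF D]
  obtain i j where ij: "i < m" "j < m" "D $$ (i, j) \<noteq> 0"
    using CD \<open>D \<noteq> 0\<^sub>m m m\<close> by (metis eq_matI carrier_matD index_zero_mat)
  obtain e where e: "0 < e" "\<And>t. \<bar>t\<bar> < e \<Longrightarrow> A + t \<cdot>\<^sub>m D \<in> Uset m"
    using eventually_neutral_perturbation_in_Uset[OF A D]
    by (auto simp: eventually_nhds_metric dist_real_def)
  define B where "B = A + (e / 2) \<cdot>\<^sub>m D"
  define C where "C = A + (- (e / 2)) \<cdot>\<^sub>m D"
  have "B \<in> Uset m" "C \<in> Uset m" using e by (simp_all add: B_def C_def)
  moreover have "B $$ (i, j) \<noteq> C $$ (i, j)" using ij e(1) CA CD by (simp add: B_def C_def)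
  then have "B \<noteq> C" by blast
  moreover have "A = (1 - 1 / 2) \<cdot>\<^sub>m B + (1 / 2) \<cdot>\<^sub>m C"
    using CA CD by (intro eq_matI) (auto simp: B_def C_def field_simps)
  moreover have "(0::real) < 1 / 2" "(1::real) / 2 < 1" by simp_all
  ultimately show False using ext unfolding extreme_mat_of_def by blast
qed

lemma extreme_mat_of_Uset_iff:
  assumes A: "A \<in> Uset m"
  shows "extreme_mat_of A (Uset m) \<longleftrightarrow> neutral_directions m A \<subseteq> {0\<^sub>m m m}"
proof
  assume trivial: "neutral_directions m A \<subseteq> {0\<^sub>m m m}"
  have "B = C"
    if segment: "B \<in> Uset m" "C \<in> Uset m" "0 < u" "u < 1" "A = (1 - u) \<cdot>\<^sub>m B + u \<cdot>\<^sub>m C" for B C u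
  proof -
    note carrier = segment(1,2)[THEN Uset_carrier_mat]
    have diff: "B - C = 0\<^sub>m m m" using trivial segment_direction_neutral[OF segment] by blast
    have "B $$ (i, j) = C $$ (i, j)" if "i < m" "j < m" for i j
      using arg_cong[OF diff, of "\<lambda>M. M $$ (i, j)"] that carrier by simp
    then show ?thesis using carrier by (intro eq_matI) auto
  qed
  with A show "extreme_mat_of A (Uset m)" unfolding extreme_mat_of_def by blast
qed (use extreme_mat_of_imp_neutral_eq_0 in blast)

section \<open>Principal submatrices of extreme points\<close>

lemma principal_submatrix_neutral:
  assumes A: "A \<in> carrier_mat m m" and \<alpha>: "\<alpha> \<subseteq> {..<m}" and D: "D \<in> neutral_directions m A"
  shows "principal_submatrix D \<alpha> \<in> neutral_directions (card \<alpha>) (principal_submatrix A \<alpha>)"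
proof -
  note CD = neutral_directions_carrier_mat[OF D]
  have "principal_sum (principal_submatrix D \<alpha>) \<gamma> = 0"
    if "saturated (principal_submatrix A \<alpha>) \<gamma>" for \<gamma>
  proof -
    have \<gamma>: "\<gamma> \<subseteq> {..<card \<alpha>}"
      using that by (simp add: saturated_iff[OF submatrix_carrier_mat[OF A \<alpha> \<alpha>]])
    then have "saturated A (pick \<alpha> ` \<gamma>)"
      using that by (simp add: saturated_principal_submatrix_iff[OF A \<alpha>])
    then show ?thesis
      using D by (simp add: principal_sum_submatrix[OF CD \<alpha> \<gamma>] neutral_directions_def)
  qed
  then show ?thesis
    using D pick_less[OF \<alpha>] submatrix_carrier_mat[OF CD \<alpha> \<alpha>]
    by (simp add: neutral_directions_def submatrix_index_pick[OF A \<alpha> \<alpha>]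
        submatrix_index_pick[OF CD \<alpha> \<alpha>])
qed

lemma principal_sum_neutral_zero_extension:
  assumes A: "A \<in> Uset m" and \<alpha>: "saturated A \<alpha>" and \<beta>: "saturated A \<beta>"
    and D: "D \<in> neutral_directions (card \<alpha>) (principal_submatrix A \<alpha>)"
  shows "principal_sum (zero_extension m m \<alpha> \<alpha> D) \<beta> = 0"
proof -
  note CA = Uset_carrier_mat[OF A]
  have sub: "\<alpha> \<subseteq> {..<m}" "\<beta> \<subseteq> {..<m}" using \<alpha> \<beta> by (simp_all add: saturated_iff[OF CA])
  have "finite \<alpha>" using finite_subset[OF sub(1)] by simp
  then obtain \<gamma> where \<gamma>: "\<gamma> \<subseteq> {..<card \<alpha>}" "pick \<alpha> ` \<gamma> = \<alpha> \<inter> \<beta>"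
    using bij_betw_imp_surj_on[OF bij_betw_pick] subset_imageE[of "\<alpha> \<inter> \<beta>"] by (metis inf_le1)
  have "principal_sum (zero_extension m m \<alpha> \<alpha> D) \<beta> = principal_sum D \<gamma>"
    by (rule principal_sum_zero_extension[OF sub neutral_directions_carrier_mat[OF D] \<gamma>])
  also have "\<dots> = 0"
  proof (cases "\<alpha> \<inter> \<beta> = {}")
    case True
    then show ?thesis using \<gamma>(2) by (simp add: principal_sum_def)
  next
    case False
    then have "saturated (principal_submatrix A \<alpha>) \<gamma>"
      using saturated_Int[OF A \<alpha> \<beta>] \<gamma> saturated_principal_submatrix_iff[OF CA sub(1) \<gamma>(1)] by simp
    then show ?thesis using D by (simp add: neutral_directions_def)
  qed
  finally show ?thesis .
qed

lemma zero_extension_neutral: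
  assumes A: "A \<in> Uset m" and \<alpha>: "saturated A \<alpha>"
    and D: "D \<in> neutral_directions (card \<alpha>) (principal_submatrix A \<alpha>)"
  shows "zero_extension m m \<alpha> \<alpha> D \<in> neutral_directions m A"
proof -
  let ?E = "zero_extension m m \<alpha> \<alpha> D"
  note CA = Uset_carrier_mat[OF A]
  have sub: "\<alpha> \<subseteq> {..<m}" using \<alpha> by (simp add: saturated_iff[OF CA])
  have "?E $$ (i, j) = ?E $$ (j, i) \<and> (A $$ (i, j) = 0 \<longrightarrow> ?E $$ (i, j) = 0)"
    if ij: "i < m" "j < m" for i j
  proof (cases "i \<in> \<alpha> \<and> j \<in> \<alpha>")
    case True
    then obtain k l where kl: "k < card \<alpha>" "l < card \<alpha>" and [simp]: "i = pick \<alpha> k" "j = pick \<alpha> l"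
      using finite_subset[OF sub] by (metis finite_lessThan pickE)
    show ?thesis
      using D kl submatrix_index_pick[OF CA sub sub kl]
      by (simp add: zero_extension_index_pick[OF sub sub] neutral_directions_def)
  next
    case False
    then show ?thesis using ij by (auto simp: zero_extension_index_outside)
  qed
  then show ?thesis
    using principal_sum_neutral_zero_extension[OF A \<alpha> _ D]
    by (simp add: neutral_directions_def zero_extension_carrier_mat)
qed

lemma extreme_mat_of_principal_submatrix:
  assumes ext: "extreme_mat_of A (Uset m)" and \<alpha>: "saturated A \<alpha>"
  shows "extreme_mat_of (principal_submatrix A \<alpha>) (Uset (card \<alpha>))"
proof -
  have A: "A \<in> Uset m" using ext by (simp add: extreme_mat_of_def)
  have sub: "\<alpha> \<subseteq> {..<m}" using \<alpha> by (simp add: saturated_iff[OF Uset_carrier_mat[OF A]])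
  have "D = 0\<^sub>m (card \<alpha>) (card \<alpha>)"
    if D: "D \<in> neutral_directions (card \<alpha>) (principal_submatrix A \<alpha>)" for D
  proof -
    note CD = neutral_directions_carrier_mat[OF D]
    have "zero_extension m m \<alpha> \<alpha> D = 0\<^sub>m m m"
      using zero_extension_neutral[OF A \<alpha> D] by (rule extreme_mat_of_imp_neutral_eq_0[OF ext])
    then show ?thesis
      using submatrix_zero_extension[OF sub sub CD] by (simp add: submatrix_zero_mat[OF sub sub])
  qed
  then show ?thesis
    using extreme_mat_of_Uset_iff[OF principal_submatrix_in_Uset[OF A sub]] by blast
qed

definition symmetric_unit :: "nat \<Rightarrow> nat \<Rightarrow> nat \<Rightarrow> 'a::zero_neq_one mat" where
  "symmetric_unit m i j = mat m m (\<lambda>(k, l). if {k, l} = {i, j} then 1 else 0)"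

lemma symmetric_unit_neutral:
  assumes A: "A \<in> Uset m" and ij: "i < m" "j < m" "A $$ (i, j) \<noteq> 0"
    and none: "\<nexists>\<beta>. saturated_nbhd A i j \<beta>"
  shows "symmetric_unit m i j \<in> neutral_directions m A"
proof -
  have "principal_sum (symmetric_unit m i j :: real mat) \<beta> = 0" if \<beta>: "saturated A \<beta>" for \<beta>
    unfolding principal_sum_def
  proof (intro sum.neutral ballI)
    fix k l assume kl: "k \<in> \<beta>" "l \<in> \<beta>"
    then have "k < m" "l < m" using \<beta> saturated_iff[OF Uset_carrier_mat[OF A]] by auto
    moreover have "{k, l} \<noteq> {i, j}"
      using none \<beta> kl by (auto simp: saturated_nbhd_def doubleton_eq_iff)
    ultimately show "(symmetric_unit m i j :: real mat) $$ (k, l) = 0"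
      by (simp add: symmetric_unit_def)
  qed
  then show ?thesis
    using ij Uset_sym[OF A ij(1,2)]
    by (auto simp: neutral_directions_def symmetric_unit_def doubleton_eq_iff)
qed

lemma extreme_mat_of_imp_ex_saturated_nbhd:
  assumes ext: "extreme_mat_of A (Uset m)" and ij: "i < m" "j < m" "A $$ (i, j) \<noteq> 0"
  shows "\<exists>\<beta>. saturated_nbhd A i j \<beta>"
proof (rule ccontr)
  assume none: "\<nexists>\<beta>. saturated_nbhd A i j \<beta>"
  have "A \<in> Uset m" using ext by (simp add: extreme_mat_of_def)
  then have "symmetric_unit m i j \<in> neutral_directions m A"
    using ij none by (rule symmetric_unit_neutral)
  then have "(symmetric_unit m i j :: real mat) = 0\<^sub>m m m"
    by (rule extreme_mat_of_imp_neutral_eq_0[OF ext])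
  then have "(symmetric_unit m i j :: real mat) $$ (i, j) = 0" using ij by simp
  then show False using ij by (simp add: symmetric_unit_def)
qed

section \<open>Local criterion for extremality\<close>

lemma Uset_le_1:
  assumes A: "A \<in> Uset m" and ij: "i < m" "j < m"
  shows "A $$ (i, j) \<le> 1"
proof (cases "i = j")
  case True
  then show ?thesis
    using Uset_principal_sum_le[OF A, of "{i}"] ij by (simp add: principal_sum_def)
next
  case False
  then show ?thesis
    using Uset_principal_sum_le[OF A, of "{i, j}"] ij Uset_sym[OF A ij]
      Uset_nonneg[OF A, of i i] Uset_nonneg[OF A, of j j] by (simp add: principal_sum_def)
qed

lemma neutral_direction_at_1:
  assumes A: "A \<in> Uset m" and D: "D \<in> neutral_directions m A"
    and ij: "i < m" "j < m" "A $$ (i, j) = 1"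
  shows "D $$ (i, j) = 0"
proof (cases "i = j")
  case True
  then have "saturated A {i}"
    using ij by (simp add: saturated_iff[OF Uset_carrier_mat[OF A]] principal_sum_def)
  then have "principal_sum D {i} = 0" using D by (simp add: neutral_directions_def)
  then show ?thesis using True by (simp add: principal_sum_def)
next
  case False
  have sym: "A $$ (j, i) = 1" "D $$ (j, i) = D $$ (i, j)"
    using ij Uset_sym[OF A] D by (auto simp: neutral_directions_def)
  have diag: "A $$ (i, i) = 0" "A $$ (j, j) = 0"
    using Uset_principal_sum_le[OF A, of "{i, j}"] False ij sym
      Uset_nonneg[OF A, of i i] Uset_nonneg[OF A, of j j] by (simp_all add: principal_sum_def)
  then have "saturated A {i, j}"
    using False ij sym by (simp add: saturated_iff[OF Uset_carrier_mat[OF A]] principal_sum_def)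
  then have "principal_sum D {i, j} = 0" using D by (simp add: neutral_directions_def)
  moreover have "D $$ (i, i) = 0" "D $$ (j, j) = 0"
    using D ij diag by (auto simp: neutral_directions_def)
  ultimately show ?thesis using False sym by (simp add: principal_sum_def)
qed

lemma neutral_direction_in_extreme_principal_submatrix:
  assumes A: "A \<in> carrier_mat m m" and D: "D \<in> neutral_directions m A"
    and \<alpha>: "\<alpha> \<subseteq> {..<m}" "i \<in> \<alpha>" "j \<in> \<alpha>"
    and ext: "extreme_mat_of (principal_submatrix A \<alpha>) (Uset (card \<alpha>))"
  shows "D $$ (i, j) = 0"
proof -
  note CD = neutral_directions_carrier_mat[OF D]
  have "principal_submatrix D \<alpha> = 0\<^sub>m (card \<alpha>) (card \<alpha>)"
    using ext principal_submatrix_neutral[OF A \<alpha>(1) D] by (rule extreme_mat_of_imp_neutral_eq_0)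
  moreover obtain k l where kl: "k < card \<alpha>" "l < card \<alpha>" "i = pick \<alpha> k" "j = pick \<alpha> l"
    using finite_subset[OF \<alpha>(1)] \<alpha>(2,3) by (metis pickE finite_lessThan)
  ultimately show ?thesis
    using submatrix_index_pick[OF CD \<alpha>(1) \<alpha>(1) kl(1,2)] by simp
qed

lemma extreme_mat_of_if_locally_extreme:
  assumes A: "A \<in> Uset m"
    and local: "\<And>i j. i < m \<Longrightarrow> j < m \<Longrightarrow> 0 < A $$ (i, j) \<Longrightarrow> A $$ (i, j) < 1 \<Longrightarrow>
      \<exists>\<alpha>\<subseteq>{..<m}. i \<in> \<alpha> \<and> j \<in> \<alpha> \<and> extreme_mat_of (principal_submatrix A \<alpha>) (Uset (card \<alpha>))"
  shows "extreme_mat_of A (Uset m)"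
proof -
  have "D = 0\<^sub>m m m" if D: "D \<in> neutral_directions m A" for D
  proof -
    have "D $$ (i, j) = 0" if ij: "i < m" "j < m" for i j
    proof -
      consider "A $$ (i, j) = 0" | "A $$ (i, j) = 1" | "0 < A $$ (i, j)" "A $$ (i, j) < 1"
        using Uset_nonneg[OF A ij] Uset_le_1[OF A ij] by linarith
      then show ?thesis
      proof cases
        assume "A $$ (i, j) = 0"
        then show ?thesis using D ij by (simp add: neutral_directions_def)
      next
        assume "A $$ (i, j) = 1"
        then show ?thesis by (rule neutral_direction_at_1[OF A D ij])
      next
        assume "0 < A $$ (i, j)" "A $$ (i, j) < 1"
        then show ?thesis
          using local[OF ij] neutral_direction_in_extreme_principal_submatrix[OF
              Uset_carrier_mat[OF A] D] by blast
      qed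
    qed
    then show ?thesis using D by (intro eq_matI) (auto simp: neutral_directions_def)
  qed
  then show ?thesis using extreme_mat_of_Uset_iff[OF A] by blast
qed

theorem theorem2p14:
  fixes m :: nat and A :: "real mat"
  assumes "A \<in> Uset m"
  defines "P1 \<equiv> extreme_mat_of A (Uset m)"
  defines "P2 \<equiv> \<forall>i<m. \<forall>j<m. 0 < A $$ (i, j) \<and> A $$ (i, j) < 1 \<longrightarrow>
      (\<exists>\<beta>. saturated_nbhd A i j \<beta>) \<and>
      (\<forall>\<alpha>. minimal_saturated_nbhd A i j \<alpha> \<longrightarrow>
         extreme_mat_of (principal_submatrix A \<alpha>) (Uset (card \<alpha>)))"
  defines "P3 \<equiv> (\<forall>i<m. \<forall>j<m. 0 < A $$ (i, j) \<and> A $$ (i, j) < 1 \<longrightarrow>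
        (\<exists>\<beta>. saturated_nbhd A i j \<beta>)) \<and>
      (\<forall>\<alpha>. saturated A \<alpha> \<longrightarrow>
         extreme_mat_of (principal_submatrix A \<alpha>) (Uset (card \<alpha>)))"
  shows "(P1 \<longleftrightarrow> P2) \<and> (P2 \<longleftrightarrow> P3)"
proof -
  have "P3" if "P1"
    using that extreme_mat_of_imp_ex_saturated_nbhd extreme_mat_of_principal_submatrix
    unfolding P1_def P3_def by (metis less_irrefl)
  moreover have "P2" if "P3"
    using that unfolding P2_def P3_def minimal_saturated_nbhd_def saturated_nbhd_def by blast
  moreover have "P1" if "P2"
    unfolding P1_def
  proof (rule extreme_mat_of_if_locally_extreme[OF assms(1)])
    fix i j assume "i < m" "j < m" "0 < A $$ (i, j)" "A $$ (i, j) < 1"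
    then obtain \<alpha> where "minimal_saturated_nbhd A i j \<alpha>"
      and ext: "extreme_mat_of (principal_submatrix A \<alpha>) (Uset (card \<alpha>))"
      using \<open>P2\<close> ex_minimal_saturated_nbhd unfolding P2_def by blast
    then have "\<alpha> \<subseteq> {..<m}" "i \<in> \<alpha>" "j \<in> \<alpha>"
      by (simp_all add: minimal_saturated_nbhd_def saturated_nbhd_def
          saturated_iff[OF Uset_carrier_mat[OF assms(1)]])
    with ext show "\<exists>\<alpha>\<subseteq>{..<m}. i \<in> \<alpha> \<and> j \<in> \<alpha> \<and>
        extreme_mat_of (principal_submatrix A \<alpha>) (Uset (card \<alpha>))" by blast
  qed
  ultimately show ?thesis by blast
qed

end
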